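(* Let $\mathcal{F}$ be any class of $n$-variate multilinear functions that is closed under restrictions, and let $1\le k\le n$. Then for any $c\in(0,1)$ with $c\le\min\left(\frac13,\,3^{-k}\frac{M_k(\mathcal{F})}{M_{k+1}(\mathcal{F})}\right)$, we have \[ \varepsilon_{c,k}(\mathcal{F})\ge\left(\frac{c}{2}\right)^k M_k(\mathcal{F}). \]
   Context: Functions are multilinear polynomials $f(\mathbf{x})=\sum_{S\subseteq[n]}\hat f(S)\mathbf{x}^S$ on $\mathbb{R}^n$, $\mathbf{x}^S=\prod_{i\in S}x_i$. Closed under restrictions: fixing any subset of the variables to values in $\{-1,1\}$ yields a function in the class. $f_k(\mathbf{x})=\sum_{|S|=k}\hat f(S)\mathbf{x}^S$, $M_k(f)=\max_{\mathbf{x}\in[-1,1]^n}|f_k(\mathbf{x})|$, $M_k(\mathcal{F})=\max_{f\in\mathcal{F}}M_k(f)$. $\varepsilon_{c,k}(f)=\inf_{g:\deg g<k}\max_{\mathbf{x}\in[-c,c]^n}|f(\mathbf{x})-g(\mathbf{x})|$ and $\varepsilon_{c,k}(\mathcal{F})=\max_{f\in\mathcal{F}}\varepsilon_{c,k}(f)$. If $M_{k+1}(\mathcal{F})=0$ the ratio is interpreted as $+\infty$. *)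

theory Defs
  imports "HOL-Analysis.Analysis"
begin

text \<open>Throughout, the \<open>n\<close> variables are indexed by a finite type, so \<open>n = CARD('n)\<close>.\<close>

definition multilinear_expansion :: "(('n::finite) set \<Rightarrow> real) \<Rightarrow> (real ^ 'n \<Rightarrow> real) \<Rightarrow> bool"
  where "multilinear_expansion a f \<longleftrightarrow> (\<forall>x. f x = (\<Sum>S\<in>UNIV. a S * (\<Prod>i\<in>S. x $ i)))"

definition multilinear_poly :: "(real ^ 'n::finite \<Rightarrow> real) \<Rightarrow> bool"
  where "multilinear_poly f \<longleftrightarrow> (\<exists>a. multilinear_expansion a f)"

lemma multilinear_expansion_zero:
  fixes a :: "('n::finite) set \<Rightarrow> real"
  assumes "\<And>x. (\<Sum>S\<in>UNIV. a S * (\<Prod>i\<in>S. x $ i)) = 0"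
  shows "a S = 0"
proof (induction "card S" arbitrary: S rule: less_induct)
  case less
  let ?x = "(\<chi> i. if i \<in> S then 1 else 0) :: real ^ 'n"
  have "a T * (\<Prod>i\<in>T. ?x $ i) = (if T = S then a S else 0)" for T
  proof -
    consider "T = S" | "T \<subset> S" | "\<not> T \<subseteq> S" by blast
    then show ?thesis
    proof cases
      case 2
      then have "a T = 0"
        using less by (simp add: psubset_card_mono)
      with 2 show ?thesis by auto
    next
      case 3
      then have "(\<Prod>i\<in>T. ?x $ i) = 0"
        by (auto intro!: prod_zero)
      with 3 show ?thesis by auto
    qed simp
  qed
  then have "(\<Sum>T\<in>UNIV. a T * (\<Prod>i\<in>T. ?x $ i)) = a S"
    by simp
  with assms[of ?x] show ?case by simp
qed

lemma multilinear_expansion_unique: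
  assumes "multilinear_expansion a f" "multilinear_expansion b f"
  shows "a = b"
proof
  fix S
  have "(\<Sum>S\<in>UNIV. (a S - b S) * (\<Prod>i\<in>S. x $ i)) = 0" for x
    using assms by (simp add: multilinear_expansion_def algebra_simps sum_subtractf)
  from multilinear_expansion_zero[of "\<lambda>S. a S - b S", OF this] show "a S = b S"
    by simp
qed

text \<open>\<open>mcoeff f S\<close> is the coefficient of the monomial indexed by \<open>S\<close>; it is meaningful only for
  multilinear \<open>f\<close>.\<close>

definition mcoeff :: "(real ^ 'n::finite \<Rightarrow> real) \<Rightarrow> 'n set \<Rightarrow> real"
  where "mcoeff f = (THE a. multilinear_expansion a f)"

lemma mcoeff_eqI: "multilinear_expansion a f \<Longrightarrow> mcoeff f = a"
  unfolding mcoeff_def by (blast intro: multilinear_expansion_unique)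

definition level :: "nat \<Rightarrow> (real ^ 'n::finite \<Rightarrow> real) \<Rightarrow> real ^ 'n \<Rightarrow> real"
  where "level k f x = (\<Sum>S\<in>{S. card S = k}. mcoeff f S * (\<Prod>i\<in>S. x $ i))"

definition cube :: "real \<Rightarrow> (real ^ 'n::finite) set"
  where "cube c = {x. \<forall>i. x $ i \<in> {- c..c}}"

text \<open>For a multilinear function this supremum, and the inner one in \<open>approx_err\<close>, is over a
  continuous function on a compact nonempty set (if \<open>c \<ge> 0\<close>), hence a maximum.\<close>

definition level_max :: "nat \<Rightarrow> (real ^ 'n::finite \<Rightarrow> real) \<Rightarrow> real"
  where "level_max k f = (SUP x\<in>cube 1. \<bar>level k f x\<bar>)"

text \<open>Arbitrary (not necessarily multilinear) real polynomials of degree below \<open>k\<close>; \<open>m\<close> ranges over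
  exponent vectors.\<close>

definition poly_degree_less :: "nat \<Rightarrow> (real ^ 'n::finite \<Rightarrow> real) \<Rightarrow> bool"
  where "poly_degree_less k g \<longleftrightarrow>
    (\<exists>a :: ('n \<Rightarrow> nat) \<Rightarrow> real. \<forall>x.
      g x = (\<Sum>m\<in>{m. (\<Sum>i\<in>UNIV. m i) < k}. a m * (\<Prod>i\<in>UNIV. (x $ i) ^ m i)))"

lemma finite_exponents: "finite {m :: 'n::finite \<Rightarrow> nat. (\<Sum>i\<in>UNIV. m i) < k}"
proof (rule finite_subset)
  show "{m :: 'n \<Rightarrow> nat. (\<Sum>i\<in>UNIV. m i) < k} \<subseteq> PiE UNIV (\<lambda>_. {..<k})"
  proof
    fix m :: "'n \<Rightarrow> nat"
    assume "m \<in> {m. (\<Sum>i\<in>UNIV. m i) < k}"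
    then have "m i < k" for i
      using member_le_sum[of i UNIV m] by simp
    then show "m \<in> PiE UNIV (\<lambda>_. {..<k})" by (simp add: PiE_iff)
  qed
qed (simp add: finite_PiE)

definition approx_err :: "real \<Rightarrow> nat \<Rightarrow> (real ^ 'n::finite \<Rightarrow> real) \<Rightarrow> real"
  where "approx_err c k f = (INF g\<in>{g. poly_degree_less k g}. SUP x\<in>cube c. \<bar>f x - g x\<bar>)"

text \<open>The coordinates in \<open>J\<close> are fixed to those of \<open>z\<close>; the result is still regarded as a function of
  all \<open>n\<close> variables.\<close>

definition restriction ::
    "'n set \<Rightarrow> real ^ 'n \<Rightarrow> (real ^ 'n::finite \<Rightarrow> real) \<Rightarrow> real ^ 'n \<Rightarrow> real"
  where "restriction J z f x = f (\<chi> i. if i \<in> J then z $ i else x $ i)"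

definition closed_under_restrictions :: "(real ^ 'n::finite \<Rightarrow> real) set \<Rightarrow> bool"
  where "closed_under_restrictions F \<longleftrightarrow>
    (\<forall>f\<in>F. \<forall>J z. (\<forall>i\<in>J. z $ i \<in> {-1, 1}) \<longrightarrow> restriction J z f \<in> F)"

text \<open>A class may be infinite, so the maxima over it are suprema in \<open>[0, \<infinity>]\<close>; they agree with
  the maxima whenever these exist.\<close>

definition class_level_max :: "nat \<Rightarrow> (real ^ 'n::finite \<Rightarrow> real) set \<Rightarrow> ennreal"
  where "class_level_max k F = (SUP f\<in>F. ennreal (level_max k f))"

definition class_approx_err :: "real \<Rightarrow> nat \<Rightarrow> (real ^ 'n::finite \<Rightarrow> real) set \<Rightarrow> ennreal"
  where "class_approx_err c k F = (SUP f\<in>F. ennreal (approx_err c k f))"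

text \<open>The case distinction matters only for \<open>0 / 0\<close>, which the library sets to \<open>0\<close>.\<close>

definition level_ratio :: "nat \<Rightarrow> (real ^ 'n::finite \<Rightarrow> real) set \<Rightarrow> ennreal"
  where "level_ratio k F =
    (if class_level_max (k + 1) F = 0 then \<infinity> else class_level_max k F / class_level_max (k + 1) F)"

end

theory Submission
  imports Defs "HOL-Computational_Algebra.Polynomial"
begin

text \<open>Let \<open>v\<close> be a vertex of the cube maximising \<open>\<bar>level k f v\<bar>\<close>. Along the line \<open>t \<mapsto> t v\<close> the
  levels up to \<open>k\<close> of \<open>f\<close> form a polynomial of degree \<open>k\<close> with leading coefficient \<open>level k f v\<close>, which
  by Chebyshev's theorem is at distance at least \<open>2 (c / 2)\<^sup>k M\<^sub>k f\<close> from every polynomial of lower degree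
  on \<open>[-c, c]\<close>. The levels above \<open>k\<close> form a Taylor remainder. Fixing each coordinate to that of \<open>v\<close>
  independently with probability \<open>s\<close> expresses the Taylor coefficient of order \<open>K = k + 1\<close> at \<open>s\<close>, times
  \<open>(1 - s)\<^sup>K\<close>, as an average of \<open>K\<close>-th levels of restrictions of \<open>f\<close>, so that coefficient is at most
  \<open>m / (1 - s)\<^sup>K\<close> with \<open>m = M\<^sub>K F\<close>; comparison with \<open>m / (1 - t)\<close>, whose corresponding coefficient is
  \<open>m / (1 - s)\<^sup>K\<^sup>+\<^sup>1\<close>, bounds the remainder by \<open>m t\<^sup>K / (1 - t) \<le> 3/2 m c\<^sup>K\<close>. The assumption on \<open>c\<close> makes
  this at most \<open>(c / 2)\<^sup>k M\<^sub>k F\<close>, half of the main term.\<close>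

section \<open>Chebyshev polynomials and least deviation from zero on an interval\<close>

fun cheb :: "nat \<Rightarrow> real poly" where
  "cheb 0 = 1"
| "cheb (Suc 0) = [:0, 1:]"
| "cheb (Suc (Suc n)) = [:0, 2:] * cheb (Suc n) - cheb n"

lemma poly_cheb_cos: "poly (cheb n) (cos \<theta>) = cos (real n * \<theta>)"
proof (induction n rule: cheb.induct)
  case (3 n)
  have "cos (real (Suc n) * \<theta> + \<theta>) + cos (real (Suc n) * \<theta> - \<theta>) = 2 * cos \<theta> * cos (real (Suc n) * \<theta>)"
    by (simp add: cos_add cos_diff)
  moreover have "real (Suc n) * \<theta> - \<theta> = real n * \<theta>" "real (Suc n) * \<theta> + \<theta> = real (Suc (Suc n)) * \<theta>"
    by (simp_all add: algebra_simps)
  ultimately show ?case using 3 by (simp add: algebra_simps)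
qed simp_all

lemma degree_cheb_le: "degree (cheb n) \<le> n"
proof (induction n rule: cheb.induct)
  case (3 n)
  have "degree ([:0, 2:] * cheb (Suc n)) \<le> Suc (Suc n)"
    using degree_mult_le[of "[:0, 2:]" "cheb (Suc n)"] 3 by simp
  then show ?case using 3 by (auto intro!: degree_diff_le)
qed simp_all

lemma coeff_cheb_top: "coeff (cheb (Suc n)) (Suc n) = 2 ^ n"
proof (induction n)
  case (Suc n)
  have "coeff (cheb n) (Suc (Suc n)) = 0"
    using degree_cheb_le[of n] by (intro coeff_eq_0) simp
  with Suc show ?case by simp
qed simp

text \<open>By the mean value theorem, \<open>- pderiv p\<close> alternates in sign at points
  between consecutive \<open>x i\<close>, again starting with a positive value; one alternation is
  lost together with one degree.\<close>

lemma degree_ge_sign_alternations: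
  fixes p :: "real poly"
  assumes "\<And>i. i < n \<Longrightarrow> x i < x (Suc i)"
    and "\<And>i. i \<le> n \<Longrightarrow> 0 < (-1) ^ i * poly p (x i)"
  shows "n \<le> degree p"
  using assms
proof (induction n arbitrary: p x)
  case (Suc n)
  have "\<exists>\<xi>. x i < \<xi> \<and> \<xi> < x (Suc i) \<and> 0 < (-1) ^ i * poly (- pderiv p) \<xi>" if "i \<le> n" for i
  proof -
    have lt: "x i < x (Suc i)" using Suc.prems(1) that by simp
    from poly_MVT[OF lt, of p] obtain \<xi> where \<xi>: "x i < \<xi>" "\<xi> < x (Suc i)"
      "poly p (x (Suc i)) - poly p (x i) = (x (Suc i) - x i) * poly (pderiv p) \<xi>" by blast
    have "0 < (-1) ^ i * poly p (x i)" "0 < (-1) ^ Suc i * poly p (x (Suc i))"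
      using Suc.prems(2) that by (auto simp del: power_Suc)
    then have "0 < (-1) ^ i * - (poly p (x (Suc i)) - poly p (x i))"
      by (simp add: algebra_simps)
    then have "0 < (x (Suc i) - x i) * ((-1) ^ i * poly (- pderiv p) \<xi>)"
      by (simp only: \<xi>(3)) (simp add: algebra_simps)
    then have "0 < (-1) ^ i * poly (- pderiv p) \<xi>"
      using lt by (metis diff_gt_0_iff_gt zero_less_mult_pos)
    then show ?thesis using \<xi> by blast
  qed
  then obtain \<xi> where \<xi>: "\<And>i. i \<le> n \<Longrightarrow> x i < \<xi> i" "\<And>i. i \<le> n \<Longrightarrow> \<xi> i < x (Suc i)"
    "\<And>i. i \<le> n \<Longrightarrow> 0 < (-1) ^ i * poly (- pderiv p) (\<xi> i)" by metis
  have "n \<le> degree (- pderiv p)"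
  proof (rule Suc.IH[of \<xi>])
    fix i assume "i < n"
    then show "\<xi> i < \<xi> (Suc i)" using \<xi>(1)[of "Suc i"] \<xi>(2)[of i] by simp
  qed (use \<xi> in auto)
  \<comment> \<open>\<open>degree (pderiv p)\<close> is \<open>degree p - 1\<close> with truncated
    subtraction, so degree 0 must be excluded.\<close>
  moreover have "degree p \<noteq> 0"
  proof
    assume "degree p = 0"
    then have "pderiv p = 0" by (simp add: pderiv_eq_0_iff)
    then show False using \<xi>(3)[of 0] by simp
  qed
  ultimately show ?case by (simp add: degree_pderiv)
qed simp

text \<open>\<open>E\<close> is the scale at which \<open>E\<close> times the Chebyshev polynomial
  stretched to \<open>{-c..c}\<close> has the same coefficient of order \<open>k\<close> as
  \<open>p\<close>. If \<open>p\<close> stayed below \<open>E\<close> in absolute value, their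
  difference would alternate in sign at the \<open>k + 1\<close> Chebyshev extrema while having
  degree below \<open>k\<close>.\<close>

lemma chebyshev_lower_bound:
  fixes p :: "real poly"
  assumes deg: "degree p \<le> Suc n" and c: "0 < c"
  shows "\<exists>t\<in>{-c..c}. 2 * (c / 2) ^ Suc n * \<bar>coeff p (Suc n)\<bar> \<le> \<bar>poly p t\<bar>"
proof (rule ccontr)
  define k where "k = Suc n"
  define A where "A = coeff p k"
  define E where "E = 2 * (c / 2) ^ k * A"
  assume "\<not> ?thesis"
  then have small: "\<bar>poly p t\<bar> < \<bar>E\<bar>" if "t \<in> {-c..c}" for t
    using that c by (force simp: E_def A_def k_def abs_mult not_le)
  have "A \<noteq> 0" using small[of c] c by (auto simp: E_def)
  then have "E \<noteq> 0" using c by (simp add: E_def)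
  define T where "T = pcompose (cheb k) [:0, 1 / c:]"
  define q where "q = smult (sgn E) (smult E T - p)"
  \<comment> \<open>Cosine decreases on \<open>[0, pi]\<close>, so the index \<open>k - i\<close>
    lists the extrema in increasing order; the sign at \<open>x i\<close> is then
    \<open>(-1) ^ (k - i)\<close>, whence the factor \<open>(-1) ^ k\<close> below.\<close>
  define x where "x i = c * cos (real (k - i) * pi / k)" for i
  have "coeff T k = 2 ^ n / c ^ k"
    unfolding T_def by (simp add: coeff_pcompose_linear coeff_cheb_top k_def power_divide)
  then have "coeff q k = 0"
    using c by (simp add: q_def A_def[symmetric] E_def power_divide) (simp add: k_def)
  moreover have "degree q \<le> k"
  proof -
    have "degree T \<le> k"
      using degree_cheb_le[of k] by (simp add: T_def degree_pcompose)
    then show ?thesis using deg unfolding q_def k_def[symmetric]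
      by (meson degree_diff_le degree_smult_le order_trans)
  qed
  ultimately have "degree q < k"
    using k_def by (metis degree_0 leading_coeff_0_iff nless_le zero_less_Suc)
  moreover have "k \<le> degree (smult ((-1) ^ k) q)"
  proof (rule degree_ge_sign_alternations)
    fix i assume "i < k"
    then have "real (k - Suc i) * pi / k < real (k - i) * pi / k"
      by (intro divide_strict_right_mono mult_strict_right_mono) auto
    moreover have "real (k - i) * pi / k \<le> pi"
      using \<open>i < k\<close> mult_right_mono[of "real (k - i)" "real k" pi] by (simp add: pos_divide_le_eq mult.commute)
    ultimately have "cos (real (k - i) * pi / k) < cos (real (k - Suc i) * pi / k)"
      by (intro cos_monotone_0_pi) (auto simp del: of_nat_diff)
    then show "x i < x (Suc i)" using c by (simp add: x_def del: of_nat_diff)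
  next
    fix i assume i: "i \<le> k"
    have "x i / c = cos (real (k - i) * pi / k)" using c by (simp add: x_def del: of_nat_diff)
    then have "poly T (x i) = cos (real (k - i) * pi)"
      using k_def by (simp add: T_def poly_pcompose poly_cheb_cos del: of_nat_diff)
    then have T: "poly T (x i) = (-1) ^ (k - i)" by (simp del: of_nat_diff)
    have "\<bar>x i\<bar> \<le> c"
      using c by (simp add: x_def abs_mult mult_left_le abs_cos_le_one del: of_nat_diff)
    then have "x i \<in> {-c..c}" by (simp add: abs_le_iff minus_le_iff)
    then have "\<bar>(-1) ^ (k - i) * sgn E * poly p (x i)\<bar> < \<bar>E\<bar>"
      using small[of "x i"] \<open>E \<noteq> 0\<close> by (simp add: abs_mult abs_sgn_eq)
    moreover have "(-1) ^ (k - i) * poly q (x i) = \<bar>E\<bar> - (-1) ^ (k - i) * sgn E * poly p (x i)"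
    proof -
      have "(-1) ^ (k - i) * poly q (x i)
          = ((-1) ^ (k - i) * (-1) ^ (k - i)) * (E * sgn E) - (-1) ^ (k - i) * sgn E * poly p (x i)"
        by (simp add: q_def T algebra_simps)
      moreover have "(-1 :: real) ^ (k - i) * (-1) ^ (k - i) = 1"
        by (simp flip: power_mult_distrib)
      ultimately show ?thesis by (simp flip: abs_sgn)
    qed
    ultimately have "0 < (-1) ^ (k - i) * poly q (x i)" by linarith
    also have "(-1 :: real) ^ (k - i) = (-1) ^ i * (-1) ^ k"
      using i by (simp add: minus_one_power_iff)
    finally show "0 < (-1) ^ i * poly (smult ((-1) ^ k) q) (x i)" by simp
  qed
  ultimately show False using degree_smult_le[of "(-1) ^ k" q] by simp
qed

section \<open>Tails of power sums compared with the geometric series\<close>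

lemma power_sum_tail_bound:
  fixes a :: "nat \<Rightarrow> real"
  assumes bnd: "\<And>s. 0 \<le> s \<Longrightarrow> s < 1 \<Longrightarrow>
      \<bar>(1 - s) ^ K * (\<Sum>j\<le>N. real (j choose K) * a j * s ^ (j - K))\<bar> \<le> m"
    and t: "0 \<le> t" "t < 1" and K: "0 < K"
  shows "\<bar>\<Sum>j=K..N. a j * t ^ j\<bar> \<le> m * t ^ K / (1 - t)"
proof (cases "t = 0")
  case True
  then show ?thesis using K by (auto simp: power_0_left intro!: sum.neutral)
next
  case False
  with t have t0: "0 < t" by simp
  have m0: "0 \<le> m" using bnd[of 0] by linarith
  \<comment> \<open>The hypothesis is insensitive to the sign of the coefficients, so taking
    \<open>a\<close> and \<open>- a\<close> for \<open>b\<close> gives both halves of the absolute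
    value.\<close>
  have main: "(\<Sum>j=K..N. b j * t ^ j) \<le> m * t ^ K / (1 - t)"
    if bnd: "\<And>s. 0 \<le> s \<Longrightarrow> s < 1 \<Longrightarrow>
      \<bar>(1 - s) ^ K * (\<Sum>j\<le>N. real (j choose K) * b j * s ^ (j - K))\<bar> \<le> m" for b
  proof -
    \<comment> \<open>\<open>D i\<close> is the \<open>i\<close>-th derivative of \<open>m / (1 - s) - (\<Sum>j\<le>N. b j * s ^ j)\<close>.\<close>
    define D where "D i s = fact i * (m / (1 - s) ^ Suc i
        - (\<Sum>j\<le>N. real (j choose i) * b j * s ^ (j - i)))" for i and s :: real
    have deriv_mono: "((\<lambda>s. fact i * (real (j choose i) * b j * s ^ (j - i))) has_real_derivative
        fact (Suc i) * (real (j choose Suc i) * b j * s ^ (j - Suc i))) (at s)" for i j s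
    proof -
      have "real (Suc i) * real (j choose Suc i) = real (j - i) * real (j choose i)"
        by (metis binomial_absorb_comp binomial_absorption of_nat_mult)
      then have eq: "fact (Suc i) * (real (j choose Suc i) * b j * s ^ (j - Suc i))
          = fact i * (real (j choose i) * b j * (real (j - i) * s ^ (j - Suc i)))"
        by (simp del: of_nat_Suc)
      show ?thesis unfolding eq
        by (auto intro!: derivative_eq_intros)
    qed
    have deriv_pole: "((\<lambda>s. fact i * (m / (1 - s) ^ Suc i)) has_real_derivative
        fact (Suc i) * (m / (1 - s) ^ Suc (Suc i))) (at s)" if "s < 1" for i s
    proof -
      have "((\<lambda>s. 1 / (1 - s)) has_real_derivative (1 / (1 - s)) ^ 2) (at s)"
        using that by (auto intro!: derivative_eq_intros simp: power2_eq_square)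
      from DERIV_cmult[OF DERIV_power[OF this, of "Suc i"], of "fact i * m"] show ?thesis
        by (simp add: power_one_over power2_eq_square mult_ac)
    qed
    have "(D i has_real_derivative D (Suc i) s) (at s)" if "s < 1" for i s
      using DERIV_diff[OF deriv_pole[OF that, of i] DERIV_sum[of "{..N}", OF deriv_mono[of i _ s]]]
      by (simp add: D_def[abs_def] right_diff_distrib sum_distrib_left)
    then have "\<exists>s>0. s < t \<and> D 0 t = (\<Sum>i<K. D i 0 / fact i * t ^ i) + D K s / fact K * t ^ K"
      using t by (intro Maclaurin t0 K) auto
    then obtain s where s: "0 < s" "s < t"
      "D 0 t = (\<Sum>i<K. D i 0 / fact i * t ^ i) + D K s / fact K * t ^ K" by blast
    \<comment> \<open>The Lagrange remainder is nonnegative: since \<open>1 - s \<le> 1\<close>, the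
      coefficient of the pole is at least the bound that the hypothesis puts on the coefficient of
      the sum.\<close>
    have "(\<Sum>j\<le>N. real (j choose K) * b j * s ^ (j - K)) \<le> m / (1 - s) ^ K"
      using bnd[of s] s t by (simp add: field_simps abs_le_iff)
    also have "\<dots> \<le> m / (1 - s) ^ Suc K"
      using s t m0 by (intro divide_left_mono power_Suc_le_self mult_pos_pos) auto
    finally have "0 \<le> D K s / fact K * t ^ K" using t by (simp add: D_def)
    with s(3) have "(\<Sum>i<K. D i 0 / fact i * t ^ i) \<le> D 0 t" by linarith
    \<comment> \<open>At 0 only \<open>j = i\<close> survives: for \<open>j < i\<close> the factor
      \<open>0 ^ (j - i)\<close> is 1, but the binomial coefficient vanishes.\<close>
    moreover have "D i 0 / fact i = m - (if i \<le> N then b i else 0)" for i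
    proof -
      have "(\<Sum>j\<le>N. real (j choose i) * b j * 0 ^ (j - i)) = (\<Sum>j\<le>N. if j = i then b i else 0)"
        by (intro sum.cong) (auto simp: power_0_left)
      then show ?thesis by (simp add: D_def)
    qed
    moreover have "D 0 t = m / (1 - t) - (\<Sum>j\<le>N. b j * t ^ j)" by (simp add: D_def)
    \<comment> \<open>These are the first \<open>K\<close> terms of both series; cancelling them
      from \<open>D 0 t\<close> leaves the two tails.\<close>
    moreover have "(\<Sum>i<K. (m - (if i \<le> N then b i else 0)) * t ^ i)
        = m * (1 - t ^ K) / (1 - t) - (\<Sum>j | j \<le> N \<and> j < K. b j * t ^ j)"
    proof -
      have "(\<Sum>i<K. (m - (if i \<le> N then b i else 0)) * t ^ i)
        = m * (\<Sum>i<K. t ^ i) - (\<Sum>i<K. if i \<le> N then b i * t ^ i else 0)"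
        by (simp add: left_diff_distrib sum_subtractf sum_distrib_left if_distrib[of "\<lambda>u. u * _"] cong: if_cong)
      also have "(\<Sum>i<K. if i \<le> N then b i * t ^ i else 0) = (\<Sum>j | j \<le> N \<and> j < K. b j * t ^ j)"
        by (subst sum.inter_filter[symmetric]) (auto intro: sum.cong)
      also have "(\<Sum>i<K. t ^ i) = (1 - t ^ K) / (1 - t)"
        using t by (simp add: sum_gp_strict)
      finally show ?thesis by simp
    qed
    moreover have "(\<Sum>j\<le>N. b j * t ^ j)
        = (\<Sum>j | j \<le> N \<and> j < K. b j * t ^ j) + (\<Sum>j=K..N. b j * t ^ j)"
      by (subst sum.union_disjoint[symmetric]) (auto intro!: sum.cong)
    ultimately show ?thesis by (simp add: algebra_simps diff_divide_distrib)
  qed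
  show ?thesis
    using main[OF bnd] main[of "\<lambda>j. - a j"] bnd by (auto simp: abs_le_iff sum_negf)
qed

section \<open>Levels of random restrictions\<close>

lemma sum_weights_card_diff:
  fixes S :: "'n::finite set" and s :: real
  shows "(\<Sum>J\<in>UNIV. s ^ card J * (1 - s) ^ card (- J) * (if card (S - J) = m then 1 else 0))
    = real (card S choose m) * (1 - s) ^ m * s ^ (card S - m)"
proof -
  \<comment> \<open>Expand \<open>(s + (1 - s) X) ^ card S\<close>, the generating function of the number of coordinates of \<open>S\<close> left free.\<close>
  let ?g = "\<lambda>i. if i \<in> S then [:0, 1 - s:] else [:1 - s:]"
  have "(\<Prod>i\<in>UNIV. [:s:] + ?g i) = (\<Prod>i\<in>UNIV. if i \<in> S then [:s, 1 - s:] else 1)"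
    by (intro prod.cong) (auto simp: one_pCons)
  also have "\<dots> = [:s, 1 - s:] ^ card S" by (simp add: prod.If_cases)
  finally have pow: "coeff ([:s, 1 - s:] ^ card S) m
      = coeff (\<Sum>J\<in>UNIV. (\<Prod>i\<in>J. [:s:]) * (\<Prod>i\<in>- J. ?g i)) m"
    by (simp add: prod_add Compl_eq_Diff_UNIV)
  have mono: "(\<Prod>i\<in>J. [:s:]) * (\<Prod>i\<in>- J. ?g i)
      = monom (s ^ card J * (1 - s) ^ card (- J)) (card (S - J))" for J
  proof -
    have "(\<Prod>i\<in>- J. ?g i) = (\<Prod>i\<in>- J. smult (1 - s) (monom 1 (if i \<in> S then 1 else 0)))"
      by (intro prod.cong) (auto simp: monom_altdef)
    also have "\<dots> = smult ((1 - s) ^ card (- J)) (\<Prod>i\<in>- J. monom 1 (if i \<in> S then 1 else 0))"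
      by (simp add: prod_smult)
    also have "(\<Prod>i\<in>- J. monom (1::real) (if i \<in> S then 1 else 0)) = monom 1 (card (- J \<inter> S))"
      by (simp add: if_distrib prod.If_cases monom_power cong: if_cong)
    also have "- J \<inter> S = S - J" by auto
    finally show ?thesis
      by (simp add: smult_monom poly_const_pow mult.commute)
  qed
  have "coeff ([:s, 1 - s:] ^ card S) m = real (card S choose m) * (1 - s) ^ m * s ^ (card S - m)"
  proof (cases "m \<le> card S")
    case False
    then have "degree ([:s, 1 - s:] ^ card S) < m"
      using degree_power_le[of "[:s, 1 - s:]" "card S"] by (auto split: if_splits)
    then show ?thesis using False by (simp add: coeff_eq_0)
  qed (simp add: coeff_linear_poly_power)
  then show ?thesis
    unfolding pow mono by (simp add: coeff_sum if_distrib cong: if_cong)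
qed

lemma multilinear_expansion_mcoeff:
  assumes "multilinear_poly f"
  shows "multilinear_expansion (mcoeff f) f"
  using assms mcoeff_eqI by (auto simp: multilinear_poly_def)

lemma multilinear_eq_sum_level:
  fixes f :: "real ^ 'n::finite \<Rightarrow> real"
  assumes "multilinear_poly f"
  shows "f x = (\<Sum>j\<le>CARD('n). level j f x)"
proof -
  have "(\<Sum>j\<le>CARD('n). \<Sum>S | S \<in> UNIV \<and> card S = j. mcoeff f S * (\<Prod>i\<in>S. x $ i))
      = (\<Sum>S\<in>UNIV. mcoeff f S * (\<Prod>i\<in>S. x $ i))"
    by (rule sum.group) (auto intro: card_mono)
  then show ?thesis
    using multilinear_expansion_mcoeff[OF assms] by (simp add: level_def multilinear_expansion_def)
qed

lemma level_scaleR: "level j f (t *\<^sub>R x) = t ^ j * level j f x"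
  by (auto simp: level_def prod.distrib sum_distrib_left intro!: sum.cong)

text \<open>Fixing the coordinates in \<open>J\<close> merges all monomials with the same free part
  \<open>S - J\<close>.\<close>

lemma mcoeff_restriction:
  assumes "multilinear_poly f"
  shows "mcoeff (restriction J z f) T = (\<Sum>S | S - J = T. mcoeff f S * (\<Prod>i\<in>S \<inter> J. z $ i))"
proof -
  let ?a = "\<lambda>T. \<Sum>S | S - J = T. mcoeff f S * (\<Prod>i\<in>S \<inter> J. z $ i)"
  have "restriction J z f x = (\<Sum>T\<in>UNIV. ?a T * (\<Prod>i\<in>T. x $ i))" for x
  proof -
    have "restriction J z f x
        = (\<Sum>S\<in>UNIV. mcoeff f S * (\<Prod>i\<in>S. if i \<in> J then z $ i else x $ i))"
      using multilinear_expansion_mcoeff[OF assms]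
      by (simp add: restriction_def multilinear_expansion_def)
    also have "\<dots> = (\<Sum>S\<in>UNIV. mcoeff f S * (\<Prod>i\<in>S \<inter> J. z $ i) * (\<Prod>i\<in>S - J. x $ i))"
      by (simp add: prod.If_cases Diff_eq mult.assoc)
    also have "\<dots> = (\<Sum>T\<in>UNIV. \<Sum>S | S \<in> UNIV \<and> S - J = T.
        mcoeff f S * (\<Prod>i\<in>S \<inter> J. z $ i) * (\<Prod>i\<in>S - J. x $ i))"
      by (rule sum.group[symmetric]) auto
    also have "\<dots> = (\<Sum>T\<in>UNIV. ?a T * (\<Prod>i\<in>T. x $ i))"
      by (auto simp: sum_distrib_right intro!: sum.cong)
    finally show ?thesis .
  qed
  then have "mcoeff (restriction J z f) = ?a"
    by (intro mcoeff_eqI) (simp add: multilinear_expansion_def)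
  then show ?thesis by simp
qed

text \<open>At the point \<open>z\<close> that supplied the fixed values, every merged monomial
  regains its full value, so the level merely selects the sets \<open>S\<close> with
  \<open>m\<close> free elements.\<close>

lemma level_restriction:
  assumes "multilinear_poly f"
  shows "level m (restriction J z f) z
    = (\<Sum>S\<in>UNIV. (if card (S - J) = m then 1 else 0) * (mcoeff f S * (\<Prod>i\<in>S. z $ i)))"
proof -
  have "level m (restriction J z f) z
      = (\<Sum>T | card T = m. \<Sum>S | S \<in> {S. card (S - J) = m} \<and> S - J = T. mcoeff f S * (\<Prod>i\<in>S. z $ i))"
    unfolding level_def mcoeff_restriction[OF assms] sum_distrib_right
  proof (rule sum.cong[OF refl], rule sum.cong)
    fix T S assume "S \<in> {S. S \<in> {S. card (S - J) = m} \<and> S - J = T}"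
    then have "(\<Prod>i\<in>S. z $ i) = (\<Prod>i\<in>S \<inter> J. z $ i) * (\<Prod>i\<in>T. z $ i)"
      by (subst prod.union_disjoint[symmetric]) (auto intro: prod.cong)
    then show "mcoeff f S * (\<Prod>i\<in>S \<inter> J. z $ i) * (\<Prod>i\<in>T. z $ i) = mcoeff f S * (\<Prod>i\<in>S. z $ i)"
      by simp
  qed auto
  also have "\<dots> = (\<Sum>S | card (S - J) = m. mcoeff f S * (\<Prod>i\<in>S. z $ i))"
    by (rule sum.group) auto
  also have "\<dots> = (\<Sum>S\<in>UNIV. (if card (S - J) = m then 1 else 0) * (mcoeff f S * (\<Prod>i\<in>S. z $ i)))"
    by (rule sum.mono_neutral_cong_left) auto
  finally show ?thesis .
qed

text \<open>Exchanging the sums leaves, for each \<open>S\<close>, the binomial probability that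
  \<open>m\<close> of its elements remain free. The right-hand sum is the Taylor coefficient of
  order \<open>m\<close> at \<open>s\<close> of \<open>f\<close> along the line through
  \<open>z\<close>.\<close>

lemma average_level_restriction:
  fixes f :: "real ^ 'n::finite \<Rightarrow> real"
  assumes "multilinear_poly f"
  shows "(\<Sum>J\<in>UNIV. s ^ card J * (1 - s) ^ card (- J) * level m (restriction J z f) z)
    = (1 - s) ^ m * (\<Sum>j\<le>CARD('n). real (j choose m) * level j f z * s ^ (j - m))"
proof -
  let ?c = "\<lambda>S. mcoeff f S * (\<Prod>i\<in>S. z $ i)"
  have "(\<Sum>J\<in>UNIV. s ^ card J * (1 - s) ^ card (- J) * level m (restriction J z f) z)
      = (\<Sum>J\<in>UNIV. \<Sum>S\<in>UNIV. s ^ card J * (1 - s) ^ card (- J) * (if card (S - J) = m then 1 else 0) * ?c S)"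
    by (simp only: level_restriction[OF assms] sum_distrib_left mult.assoc)
  also have "\<dots> = (\<Sum>S\<in>UNIV. \<Sum>J\<in>UNIV. s ^ card J * (1 - s) ^ card (- J) * (if card (S - J) = m then 1 else 0) * ?c S)"
    by (rule sum.swap)
  also have "\<dots> = (\<Sum>S\<in>UNIV. real (card S choose m) * (1 - s) ^ m * s ^ (card S - m) * ?c S)"
    by (simp only: sum_weights_card_diff flip: sum_distrib_right)
  also have "\<dots> = (\<Sum>j\<le>CARD('n). \<Sum>S | S \<in> UNIV \<and> card S = j.
      real (card S choose m) * (1 - s) ^ m * s ^ (card S - m) * ?c S)"
    by (rule sum.group[symmetric]) (auto intro: card_mono)
  also have "\<dots> = (1 - s) ^ m * (\<Sum>j\<le>CARD('n). real (j choose m) * level j f z * s ^ (j - m))"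
    by (auto simp: level_def sum_distrib_left sum_distrib_right intro!: sum.cong)
  finally show ?thesis .
qed

text \<open>For \<open>0 \<le> s < 1\<close> the weights form a probability distribution, so the
  average of the restricted levels stays within \<open>m\<close>; this is the hypothesis of
  \<open>power_sum_tail_bound\<close>.\<close>

lemma level_tail_bound:
  fixes f :: "real ^ 'n::finite \<Rightarrow> real"
  assumes f: "multilinear_poly f" and m: "\<And>J. \<bar>level K (restriction J z f) z\<bar> \<le> m"
    and t: "0 \<le> t" "t < 1" and K: "0 < K"
  shows "\<bar>\<Sum>j=K..CARD('n). level j f (t *\<^sub>R z)\<bar> \<le> m * t ^ K / (1 - t)"
proof -
  have "\<bar>(1 - s) ^ K * (\<Sum>j\<le>CARD('n). real (j choose K) * level j f z * s ^ (j - K))\<bar> \<le> m"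
    if s: "0 \<le> s" "s < 1" for s
  proof -
    let ?w = "\<lambda>J :: 'n set. s ^ card J * (1 - s) ^ card (- J)"
    have "(\<Prod>i\<in>(UNIV :: 'n set). s + (1 - s)) = (\<Sum>J\<in>UNIV. ?w J)"
      by (subst prod_add) (simp_all add: Compl_eq_Diff_UNIV)
    then have w: "(\<Sum>J\<in>UNIV. ?w J) = 1" by simp
    have "\<bar>\<Sum>J\<in>UNIV. ?w J * level K (restriction J z f) z\<bar> \<le> (\<Sum>J\<in>UNIV. ?w J * m)"
      using s m by (intro order_trans[OF sum_abs] sum_mono) (simp add: abs_mult mult_left_mono)
    also have "\<dots> = m" using w by (simp flip: sum_distrib_right)
    finally show ?thesis by (simp add: average_level_restriction[OF f])
  qed
  from power_sum_tail_bound[OF this t K] show ?thesis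
    by (simp add: level_scaleR mult.commute)
qed

section \<open>Maxima of levels over the cube\<close>

lemma abs_level_le_level_max:
  assumes "x \<in> cube 1"
  shows "\<bar>level k f x\<bar> \<le> level_max k f"
proof -
  have "bdd_above ((\<lambda>x. \<bar>level k f x\<bar>) ` cube 1)"
  proof (rule bdd_aboveI2)
    fix x :: "real ^ 'a" assume x: "x \<in> cube 1"
    have "\<bar>\<Prod>i\<in>S. x $ i\<bar> \<le> 1" for S
      using x by (auto simp: cube_def abs_prod abs_le_iff minus_le_iff intro!: prod_le_1)
    then show "\<bar>level k f x\<bar> \<le> (\<Sum>S | card S = k. \<bar>mcoeff f S\<bar>)"
      unfolding level_def
      by (intro order_trans[OF sum_abs] sum_mono) (simp add: abs_mult mult_left_le)
  qed
  then show ?thesis unfolding level_max_def using assms by (rule cSUP_upper2) simp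
qed

lemma level_max_attained_at_vertex:
  fixes f :: "real ^ 'n::finite \<Rightarrow> real"
  obtains v where "\<And>i. v $ i \<in> {-1, 1}" "level_max k f \<le> \<bar>level k f v\<bar>"
proof -
  define V :: "'n set \<Rightarrow> real ^ 'n" where "V J = (\<chi> i. if i \<in> J then 1 else -1)" for J
  let ?L = "range (\<lambda>J. \<bar>level k f (V J)\<bar>)"
  have "Max ?L \<in> ?L" by (rule Max_in) auto
  then obtain A where "Max ?L = \<bar>level k f (V A)\<bar>" by blast
  then have A: "\<bar>level k f (V J)\<bar> \<le> \<bar>level k f (V A)\<bar>" for J
    using Max_ge[of ?L "\<bar>level k f (V J)\<bar>"] by simp
  have "\<bar>level k f x\<bar> \<le> \<bar>level k f (V A)\<bar>" if x: "x \<in> cube 1" for x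
  proof -
    \<comment> \<open>\<open>x\<close> is the mean of a product measure on the vertices, under which every monomial has mean its value at \<open>x\<close>.\<close>
    let ?w = "\<lambda>J. (\<Prod>i\<in>J. (1 + x $ i) / 2) * (\<Prod>i\<in>- J. (1 - x $ i) / 2)"
    have monomial: "(\<Prod>i\<in>S. x $ i) = (\<Sum>J\<in>UNIV. ?w J * (\<Prod>i\<in>S. V J $ i))" for S
    proof -
      \<comment> \<open>The two values add up to \<open>x $ i\<close> if \<open>i \<in> S\<close>
        and to 1 otherwise.\<close>
      let ?p = "\<lambda>i. (1 + x $ i) / 2" and ?q = "\<lambda>i. (1 - x $ i) / 2 * (if i \<in> S then -1 else 1)"
      have "(\<Prod>i\<in>S. x $ i) = (\<Prod>i\<in>UNIV. if i \<in> S then x $ i else 1)"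
        by (simp add: prod.If_cases)
      also have "\<dots> = (\<Prod>i\<in>UNIV. ?p i + ?q i)"
        by (intro prod.cong) (auto simp: field_simps)
      also have "\<dots> = (\<Sum>J\<in>UNIV. (\<Prod>i\<in>J. ?p i) * (\<Prod>i\<in>- J. ?q i))"
        by (subst prod_add) (simp_all add: Compl_eq_Diff_UNIV)
      also have "\<dots> = (\<Sum>J\<in>UNIV. ?w J * (\<Prod>i\<in>S. V J $ i))"
      proof (intro sum.cong refl)
        fix J
        have "(\<Prod>i\<in>- J. if i \<in> S then -1 else 1) = (\<Prod>i\<in>S. V J $ i)"
          by (simp add: V_def prod.If_cases Int_commute)
        then show "(\<Prod>i\<in>J. ?p i) * (\<Prod>i\<in>- J. ?q i) = ?w J * (\<Prod>i\<in>S. V J $ i)"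
          by (simp only: prod.distrib mult.assoc)
      qed
      finally show ?thesis .
    qed
    have w0: "0 \<le> ?w J" for J
      using x by (auto simp: cube_def intro!: mult_nonneg_nonneg prod_nonneg) (smt (verit))+
    have w1: "(\<Sum>J\<in>UNIV. ?w J) = 1" using monomial[of "{}"] by simp
    have "level k f x = (\<Sum>S | card S = k. \<Sum>J\<in>UNIV. ?w J * (mcoeff f S * (\<Prod>i\<in>S. V J $ i)))"
      by (simp add: level_def monomial sum_distrib_left ac_simps)
    also have "\<dots> = (\<Sum>J\<in>UNIV. ?w J * level k f (V J))"
      by (subst sum.swap) (simp add: level_def sum_distrib_left)
    finally have "\<bar>level k f x\<bar> = \<bar>\<Sum>J\<in>UNIV. ?w J * level k f (V J)\<bar>" by simp
    also have "\<dots> \<le> (\<Sum>J\<in>UNIV. ?w J * \<bar>level k f (V A)\<bar>)"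
      by (intro order_trans[OF sum_abs] sum_mono) (simp only: abs_mult[of "?w _"] abs_of_nonneg[OF w0] mult_left_mono A w0)
    also have "\<dots> = \<bar>level k f (V A)\<bar>" using w1 by (simp flip: sum_distrib_right)
    finally show ?thesis .
  qed
  moreover have "0 \<in> cube 1" by (simp add: cube_def)
  ultimately have "level_max k f \<le> \<bar>level k f (V A)\<bar>"
    unfolding level_max_def by (intro cSUP_least) auto
  then show thesis by (intro that[of "V A"]) (auto simp: V_def)
qed

section \<open>Approximation error of a single function\<close>

lemma multilinear_poly_continuous:
  assumes "multilinear_poly f"
  shows "continuous_on X f"
proof -
  have eq: "f = (\<lambda>x. \<Sum>S\<in>UNIV. mcoeff f S * (\<Prod>i\<in>S. x $ i))"
    using multilinear_expansion_mcoeff[OF assms] by (auto simp: multilinear_expansion_def)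
  show ?thesis
    by (subst eq) (intro continuous_intros)
qed

lemma poly_degree_less_continuous:
  assumes "poly_degree_less k g"
  shows "continuous_on X g"
proof -
  obtain a where "g = (\<lambda>x. \<Sum>m\<in>{m. (\<Sum>i\<in>UNIV. m i) < k}. a m * (\<Prod>i\<in>UNIV. (x $ i) ^ m i))"
    using assms by (auto simp: poly_degree_less_def)
  then show ?thesis by (simp only:) (intro continuous_intros)
qed

text \<open>On a line through the origin a monomial becomes a multiple of the power of
  \<open>t\<close> given by its total degree. The zero polynomial has degree 0, hence
  \<open>0 < k\<close>.\<close>

lemma poly_degree_less_line:
  assumes "poly_degree_less k g" "0 < k"
  obtains q where "degree q < k" "\<And>t. g (t *\<^sub>R v) = poly q t"
proof -
  obtain a where a: "\<And>x. g x = (\<Sum>m\<in>{m. (\<Sum>i\<in>UNIV. m i) < k}. a m * (\<Prod>i\<in>UNIV. (x $ i) ^ m i))"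
    using assms by (auto simp: poly_degree_less_def)
  define q where "q = (\<Sum>m\<in>{m. (\<Sum>i\<in>UNIV. m i) < k}.
      monom (a m * (\<Prod>i\<in>UNIV. (v $ i) ^ m i)) (\<Sum>i\<in>UNIV. m i))"
  have "degree q < k"
    unfolding q_def
    by (rule degree_sum_less) (use \<open>0 < k\<close> in \<open>auto intro: le_less_trans[OF degree_monom_le]\<close>)
  moreover have "g (t *\<^sub>R v) = poly q t" for t
    by (simp add: a q_def poly_sum poly_monom power_mult_distrib prod.distrib power_sum ac_simps)
  ultimately show thesis by (rule that)
qed

text \<open>The bound \<open>m\<close> is uniform over all restrictions, so that a class closed
  under restrictions can supply it for each of its members.\<close>

lemma approx_err_ge:
  fixes f :: "real ^ 'n::finite \<Rightarrow> real"
  assumes f: "multilinear_poly f" and k: "1 \<le> k" "k \<le> CARD('n)" and c: "0 < c" "c \<le> 1 / 3"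
    and m: "\<And>J z. \<forall>i\<in>J. z $ i \<in> {-1, 1} \<Longrightarrow> level_max (k + 1) (restriction J z f) \<le> m"
  shows "2 * (c / 2) ^ k * level_max k f - 3 / 2 * c ^ (k + 1) * m \<le> approx_err c k f"
  unfolding approx_err_def
proof (rule cINF_greatest)
  have "poly_degree_less k (\<lambda>x :: real ^ 'n. 0)"
    unfolding poly_degree_less_def by (rule exI[of _ "\<lambda>_. 0"]) simp
  then show "{g :: real ^ 'n \<Rightarrow> real. poly_degree_less k g} \<noteq> {}" by blast
next
  fix g :: "real ^ 'n \<Rightarrow> real" assume "g \<in> {g. poly_degree_less k g}"
  then have g: "poly_degree_less k g" by simp
  obtain v where v: "\<And>i. v $ i \<in> {-1, 1}" "level_max k f \<le> \<bar>level k f v\<bar>"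
    using level_max_attained_at_vertex[of k f] by blast
  obtain q where q: "degree q < k" "\<And>t. g (t *\<^sub>R v) = poly q t"
    using poly_degree_less_line[OF g] k by auto
  define p where "p = (\<Sum>j\<le>k. monom (level j f v) j) - q"
  have "degree p \<le> k"
    unfolding p_def using q
    by (intro degree_diff_le degree_sum_le) (auto intro: order_trans[OF degree_monom_le])
  moreover have "coeff p k = level k f v"
    using q by (simp add: p_def coeff_sum coeff_eq_0)
  ultimately obtain t where t: "t \<in> {-c..c}" "2 * (c / 2) ^ k * \<bar>level k f v\<bar> \<le> \<bar>poly p t\<bar>"
    using chebyshev_lower_bound[of p "k - 1" c] k c by auto
  have tail: "\<bar>\<Sum>j=k + 1..CARD('n). level j f (t *\<^sub>R v)\<bar> \<le> 3 / 2 * c ^ (k + 1) * m"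
  proof -
    \<comment> \<open>The Chebyshev point \<open>t\<close> may be negative, but the tail bound wants
      a nonnegative parameter; the sign is moved into the vertex.\<close>
    define w where "w = (if 0 \<le> t then v else - v)"
    have w: "t *\<^sub>R v = \<bar>t\<bar> *\<^sub>R w" "w $ i \<in> {-1, 1}" for i
      using v(1)[of i] by (auto simp: w_def)
    have "w $ i \<in> {-1..1}" for i using w(2)[of i] by auto
    then have "w \<in> cube 1" by (simp add: cube_def)
    then have lev: "\<bar>level (k + 1) (restriction J w f) w\<bar> \<le> m" for J
      using m[of J w] w(2) abs_level_le_level_max order_trans by blast
    have m0: "0 \<le> m" using lev abs_ge_zero order_trans by blast
    have "\<bar>\<Sum>j=k + 1..CARD('n). level j f (t *\<^sub>R v)\<bar> \<le> m * \<bar>t\<bar> ^ (k + 1) / (1 - \<bar>t\<bar>)"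
      unfolding w(1) using t c by (intro level_tail_bound f lev) auto
    \<comment> \<open>\<open>\<bar>t\<bar> \<le> c \<le> 1 / 3\<close> keeps the denominator at
      least \<open>2 / 3\<close>.\<close>
    also have "\<dots> \<le> m * c ^ (k + 1) / (2 / 3)"
      using t c m0 by (intro frac_le mult_left_mono power_mono mult_nonneg_nonneg) auto
    finally show ?thesis by (simp add: mult_ac)
  qed
  have "f (t *\<^sub>R v) = (\<Sum>j\<le>k. level j f (t *\<^sub>R v)) + (\<Sum>j=k + 1..CARD('n). level j f (t *\<^sub>R v))"
    using k by (subst multilinear_eq_sum_level[OF f], subst sum.union_disjoint[symmetric])
      (auto intro!: sum.cong)
  then have "f (t *\<^sub>R v) - g (t *\<^sub>R v) = poly p t + (\<Sum>j=k + 1..CARD('n). level j f (t *\<^sub>R v))"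
    by (simp add: p_def q poly_sum poly_monom level_scaleR mult.commute)
  moreover have "2 * (c / 2) ^ k * level_max k f \<le> 2 * (c / 2) ^ k * \<bar>level k f v\<bar>"
    using v c by (intro mult_left_mono) auto
  ultimately have big: "2 * (c / 2) ^ k * level_max k f - 3 / 2 * c ^ (k + 1) * m
      \<le> \<bar>f (t *\<^sub>R v) - g (t *\<^sub>R v)\<bar>"
    using t tail by linarith
  have "cube c = cbox (\<chi> i. - c) (\<chi> i. c :: real ^ 'n)"
    by (auto simp: cube_def mem_box_cart)
  then have "compact (cube c :: (real ^ 'n) set)" by simp
  \<comment> \<open>Boundedness lets the value at one point bound the real supremum from
    below.\<close>
  then have bdd: "bdd_above ((\<lambda>x. \<bar>f x - g x\<bar>) ` cube c)"
    by (intro bounded_imp_bdd_above compact_imp_bounded compact_continuous_image continuous_intros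
      multilinear_poly_continuous f poly_degree_less_continuous[OF g])
  have "t *\<^sub>R v \<in> cube c"
  proof -
    have "t * v $ i \<in> {-c..c}" for i using t v(1)[of i] by auto
    then show ?thesis by (simp add: cube_def)
  qed
  then show "2 * (c / 2) ^ k * level_max k f - 3 / 2 * c ^ (k + 1) * m \<le> (SUP x\<in>cube c. \<bar>f x - g x\<bar>)"
    using bdd big by (intro cSUP_upper2)
qed

section \<open>Passage to the class, in extended nonnegative reals\<close>

theorem theorem3p7:
  fixes F :: "(real ^ 'n::finite \<Rightarrow> real) set" and k :: nat and c :: real
  assumes "\<forall>f\<in>F. multilinear_poly f"
    and "closed_under_restrictions F"
    and "1 \<le> k" and "k \<le> CARD('n)"
    and "0 < c" and "c < 1"
    and "ennreal c \<le> min (ennreal (1 / 3)) (ennreal (1 / 3 ^ k) * level_ratio k F)"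
  shows "class_approx_err c k F \<ge> ennreal ((c / 2) ^ k) * class_level_max k F"
proof -
  let ?Mk = "class_level_max k F" and ?Mk1 = "class_level_max (k + 1) F"
  have c3: "c \<le> 1 / 3" using assms(5,7) by simp
  \<comment> \<open>Division by \<open>\<infinity>\<close> gives 0, even for
    \<open>\<infinity> / \<infinity>\<close>, which would contradict \<open>0 < c\<close>.\<close>
  have "?Mk1 \<noteq> \<infinity>"
  proof
    assume "?Mk1 = \<infinity>"
    then have "ennreal c \<le> 0" using assms(7) by (simp add: level_ratio_def)
    then show False using assms(5) by simp
  qed
  then obtain m where m: "?Mk1 = ennreal m" "0 \<le> m"
    by (cases ?Mk1) auto
  have level_bound: "level_max (k + 1) f \<le> m" if "f \<in> F" for f
  proof -
    have "ennreal (level_max (k + 1) f) \<le> ?Mk1"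
      unfolding class_level_max_def using that by (rule SUP_upper)
    then show ?thesis using m by simp
  qed
  define E where "E = 3 / 2 * c ^ (k + 1) * m"
  define d where "d = (c / 2) ^ k"
  have E0: "0 \<le> E" and d0: "0 < d" using assms(5) m by (auto simp: E_def d_def)
  \<comment> \<open>The error term stands on the right because \<open>ennreal\<close> truncates
    negative differences to 0.\<close>
  have "ennreal (2 * d) * ennreal (level_max k f) \<le> class_approx_err c k F + ennreal E" if "f \<in> F" for f
  proof -
    have "2 * d * level_max k f - E \<le> approx_err c k f"
      unfolding d_def E_def
      using assms that level_bound c3
      by (intro approx_err_ge) (auto simp: closed_under_restrictions_def)
    then have "ennreal (2 * d * level_max k f) \<le> ennreal (approx_err c k f + E)"
      by (intro ennreal_leI) simp
    also have "\<dots> \<le> ennreal (approx_err c k f) + ennreal E"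
      using E0 by (cases "0 \<le> approx_err c k f") (auto simp: ennreal_neg intro: ennreal_leI)
    also have "\<dots> \<le> class_approx_err c k F + ennreal E"
      unfolding class_approx_err_def using that by (intro add_right_mono SUP_upper)
    finally show ?thesis using d0 by (simp add: ennreal_mult')
  qed
  then have main: "ennreal (2 * d) * ?Mk \<le> class_approx_err c k F + ennreal E"
    unfolding class_level_max_def SUP_mult_left_ennreal by (intro SUP_least)
  have E_le: "ennreal E \<le> ennreal d * ?Mk"
  \<comment> \<open>For \<open>m = 0\<close> the ratio carries no information, but \<open>E\<close>
    vanishes.\<close>
  proof (cases "m = 0")
    case False
    then have m0: "0 < m" using m by simp
    show ?thesis
    proof (cases ?Mk)
      case (real r)
      have "ennreal c \<le> ennreal (1 / 3 ^ k) * (ennreal r / ennreal m)"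
        using assms(7) m m0 real by (simp add: level_ratio_def)
      also have "\<dots> = ennreal (1 / 3 ^ k * (r / m))"
        using m0 real by (simp add: divide_ennreal flip: ennreal_mult)
      finally have "c \<le> 1 / 3 ^ k * (r / m)" using real m0 by simp
      then have cm: "c * m \<le> r / 3 ^ k" using m0 by (simp add: field_simps)
      \<comment> \<open>With \<open>1 \<le> k\<close>, the factor \<open>1 / 3 ^ k\<close> in the
        bound on \<open>c\<close> absorbs the \<open>3 / 2\<close> of the tail and leaves
        \<open>(1 / 2) ^ k\<close>.\<close>
      have "(3 / 2 :: real) \<le> (3 / 2) ^ k" using assms(3) power_increasing[of 1 k "3 / 2 :: real"] by simp
      then have "3 / 2 * (1 / 3 ^ k) \<le> (1 / 2 :: real) ^ k" by (simp add: field_simps)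
      then have "3 / 2 * (r / 3 ^ k) \<le> r * (1 / 2) ^ k"
        using real mult_left_mono[of "3 / 2 * (1 / 3 ^ k)" "(1 / 2) ^ k" r] by (simp add: field_simps)
      then have "3 / 2 * (c * m) \<le> r * (1 / 2) ^ k" using cm by linarith
      then have "c ^ k * (3 / 2 * (c * m)) \<le> c ^ k * (r * (1 / 2) ^ k)"
        using assms(5) by (intro mult_left_mono) auto
      then have "E \<le> d * r" by (simp add: E_def d_def power_divide mult_ac)
      then show ?thesis using real d0 by (simp flip: ennreal_mult)
    qed (use d0 in \<open>simp add: ennreal_mult_top\<close>)
  qed (simp add: E_def)
  show ?thesis
  \<comment> \<open>Cancelling \<open>E\<close> requires finite quantities; a finite error forces
    \<open>?Mk\<close> to be finite through \<open>main\<close>.\<close>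
  proof (cases "class_approx_err c k F")
    case (real e)
    then have "ennreal (2 * d) * ?Mk \<noteq> \<infinity>" using main by (auto simp: top_unique)
    then obtain r where r: "?Mk = ennreal r" "0 \<le> r"
      using d0 by (cases ?Mk) (auto simp: ennreal_mult_top)
    have "2 * d * r \<le> e + E" using main r real d0 E0 by (simp flip: ennreal_mult ennreal_plus)
    moreover have "E \<le> d * r" using E_le r d0 by (simp flip: ennreal_mult)
    ultimately have "d * r \<le> e" by linarith
    then show ?thesis using r real d0 by (simp add: d_def flip: ennreal_mult)
  qed simp
qed

end
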